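(* Let $K,L\in\mathcal{K}^n$, let $i$ be an integer with $0\le i<n$, and let $p\ge1$. Then $$A_i(K+_pL)^{-p/(n-i)}\ge A_i(K)^{-p/(n-i)}+A_i(L)^{-p/(n-i)},$$ with equality if and only if $K$ and $L$ have similar width.
   Context: $\mathcal{K}^n$ is the class of convex bodies (compact convex sets with nonempty interior) in $\mathbb{R}^n$ containing the origin in their interiors. The support function is $h(K,x)=\max\{x\cdot y:y\in K\}$, and the half width of $K$ in direction $u\in S^{n-1}$ is $b(K,u)=\frac12(h(K,u)+h(K,-u))$. $K$ and $L$ have similar width if there is a constant $\lambda>0$ with $b(K,u)=\lambda b(L,u)$ for all $u\in S^{n-1}$. $dS$ is the surface area measure on the unit sphere $S^{n-1}$. For an integer $0\le i<n$ the width integral is $A_i(K)=\frac1n\int_{S^{n-1}}b(K,u)^{n-i}\,dS(u)$. The $L_p$-width addition $K+_pL$ (not the Firey $L_p$ sum) is defined through its half width function: for all $u\in S^{n-1}$, $$b(K+_pL,u)^{-p}=b(K,u)^{-p}+b(L,u)^{-p},\qquad b(K+_pL,u)>0.$$ The quantity $A_i(K+_pL)$ is $\frac1n\int_{S^{n-1}}b(K+_pL,u)^{n-i}\,dS(u)$. *)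

theory Defs
  imports "HOL-Analysis.Analysis"
begin

definition convex_body :: "'a::euclidean_space set \<Rightarrow> bool" where
  "convex_body K \<longleftrightarrow> compact K \<and> convex K \<and> 0 \<in> interior K"

definition support_fun :: "'a::euclidean_space set \<Rightarrow> 'a \<Rightarrow> real" where
  "support_fun K x = (SUP y\<in>K. x \<bullet> y)"

definition half_width :: "'a::euclidean_space set \<Rightarrow> 'a \<Rightarrow> real" where
  "half_width K u = (support_fun K u + support_fun K (- u)) / 2"

definition similar_width :: "'a::euclidean_space set \<Rightarrow> 'a set \<Rightarrow> bool" where
  "similar_width K L \<longleftrightarrow>
     (\<exists>l>0. \<forall>u\<in>sphere 0 1. half_width K u = l * half_width L u)"

text \<open>Surface area on the unit sphere in polar coordinates: \<open>n\<close> times the push-forward of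
  Lebesgue measure on the punctured unit ball under the radial projection
  \<open>x \<mapsto> x / \<bar>x\<bar>\<close> (the library's \<^const>\<open>sgn\<close>).\<close>

definition sphere_measure :: "'a::euclidean_space measure" where
  "sphere_measure = scale_measure (of_nat DIM('a))
     (distr (restrict_space lborel (ball 0 1 - {0})) (restrict_space borel (sphere 0 1)) sgn)"

text \<open>Width integrals are introduced for an arbitrary function \<open>w\<close> in place of the half width,
  because the \<open>L\<^sub>p\<close>-width sum below is given only by its half width function, which need not
  be the half width of an actual convex body.\<close>

definition width_integral_of :: "nat \<Rightarrow> ('a::euclidean_space \<Rightarrow> real) \<Rightarrow> real" where
  "width_integral_of i w =
     1 / real DIM('a) * (\<integral>u. w u ^ (DIM('a) - i) \<partial>sphere_measure)"

definition width_integral :: "nat \<Rightarrow> 'a::euclidean_space set \<Rightarrow> real" where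
  "width_integral i K = width_integral_of i (half_width K)"

definition half_width_Lp_sum ::
    "real \<Rightarrow> 'a::euclidean_space set \<Rightarrow> 'a set \<Rightarrow> 'a \<Rightarrow> real" where
  "half_width_Lp_sum p K L u =
     (THE b. b > 0 \<and> b powr (- p) = half_width K u powr (- p) + half_width L u powr (- p))"

lemma support_fun_pos:
  assumes "convex_body K" and "norm u = 1"
  shows "support_fun K u > 0"
proof -
  from assms(1) obtain r where r: "r > 0" "cball 0 r \<subseteq> K"
    unfolding convex_body_def mem_interior_cball by auto
  have mem: "r *\<^sub>R u \<in> K" using r assms(2) by auto
  have "bdd_above ((\<lambda>y. u \<bullet> y) ` K)"
    using assms(1) unfolding convex_body_def
    by (intro compact_imp_bounded[THEN bounded_imp_bdd_above] compact_continuous_image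
        continuous_intros) auto
  then have "u \<bullet> (r *\<^sub>R u) \<le> support_fun K u"
    unfolding support_fun_def using mem by (rule cSUP_upper[rotated])
  moreover have "u \<bullet> (r *\<^sub>R u) = r"
    using assms(2) by (simp add: dot_square_norm)
  ultimately show ?thesis using r by simp
qed

lemma half_width_pos:
  assumes "convex_body K" and "norm u = 1"
  shows "half_width K u > 0"
  using support_fun_pos[of K u] support_fun_pos[of K "- u"] assms
  by (simp add: half_width_def)

lemma half_width_Lp_sum:
  assumes "convex_body K" "convex_body L" "norm u = 1" "p \<ge> 1"
  shows "half_width_Lp_sum p K L u > 0"
    and "half_width_Lp_sum p K L u powr (- p)
           = half_width K u powr (- p) + half_width L u powr (- p)"
proof -
  define s where "s = half_width K u powr (- p) + half_width L u powr (- p)"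
  have s: "s > 0"
    using half_width_pos[of K u] half_width_pos[of L u] assms by (simp add: s_def add_pos_pos)
  have "\<exists>!b. b > 0 \<and> b powr (- p) = s"
  proof (rule ex1I[of _ "s powr (- 1 / p)"])
    show "s powr (- 1 / p) > 0 \<and> (s powr (- 1 / p)) powr (- p) = s"
      using s assms(4) by (simp add: powr_powr)
  next
    fix b assume "b > 0 \<and> b powr (- p) = s"
    then show "b = s powr (- 1 / p)"
      using assms(4) by (auto simp: powr_powr)
  qed
  from theI'[OF this] show "half_width_Lp_sum p K L u > 0"
    and "half_width_Lp_sum p K L u powr (- p)
           = half_width K u powr (- p) + half_width L u powr (- p)"
    by (simp_all add: half_width_Lp_sum_def s_def)
qed

lemma width_integral_of_half_width_Lp_sum:
  fixes K L M :: "'a::euclidean_space set"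
  assumes "convex_body K" "convex_body L" "convex_body M" "p \<ge> 1"
    and "\<And>u. norm u = 1 \<Longrightarrow>
      half_width M u powr (- p) = half_width K u powr (- p) + half_width L u powr (- p)"
  shows "width_integral_of i (half_width_Lp_sum p K L) = width_integral i M"
proof -
  have "half_width_Lp_sum p K L u = half_width M u" if "norm u = 1" for u
    unfolding half_width_Lp_sum_def
  proof (rule the_equality)
    show "half_width M u > 0 \<and>
      half_width M u powr (- p) = half_width K u powr (- p) + half_width L u powr (- p)"
      using half_width_pos[OF assms(3) that] assms(5)[OF that] by blast
  next
    fix b assume b: "b > 0 \<and> b powr (- p) = half_width K u powr (- p) + half_width L u powr (- p)"
    then have "b powr (- p) = half_width M u powr (- p)"
      using assms(5)[OF that] by simp
    moreover have "c = (c powr (- p)) powr (- 1 / p)" if "c > 0" for c :: real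
      using that assms(4) by (simp add: powr_powr)
    ultimately show "b = half_width M u"
      using b half_width_pos[OF assms(3) that] by metis
  qed
  then show ?thesis
    unfolding width_integral_def width_integral_of_def
    by (intro arg_cong2[where f = "(*)"] refl Bochner_Integration.integral_cong)
      (auto simp: sphere_measure_def space_scale_measure space_restrict_space)
qed

lemma sgn_measurable_sphere:
  "sgn \<in> restrict_space lborel (ball 0 1 - {0}) \<rightarrow>\<^sub>M
     restrict_space borel (sphere 0 (1::real) :: 'a::euclidean_space set)"
proof (rule measurable_restrict_space2)
  show "sgn \<in> space (restrict_space lborel (ball 0 1 - {0})) \<rightarrow> sphere (0::'a) 1"
    by (auto simp: space_restrict_space norm_sgn)
  have "sgn \<in> borel_measurable (borel :: 'a measure)"
    unfolding sgn_div_norm by measurable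
  then show "sgn \<in> borel_measurable (restrict_space lborel (ball (0::'a) 1 - {0}))"
    by (intro measurable_restrict_space1) simp
qed

lemma space_sphere_measure: "space sphere_measure = sphere 0 1"
  by (simp add: sphere_measure_def space_scale_measure space_restrict_space)

text \<open>The measure of \<open>A\<close> is \<open>n\<close> times the volume of the cone over \<open>A\<close> with apex at the origin.\<close>

lemma emeasure_sphere_measure:
  fixes A :: "'a::euclidean_space set"
  assumes "A \<in> sets borel" "A \<subseteq> sphere 0 1"
  shows "emeasure sphere_measure A =
    of_nat DIM('a) * emeasure lborel {r *\<^sub>R u | r u. 0 < r \<and> r < 1 \<and> u \<in> A}"
proof -
  have A: "A \<in> sets (restrict_space borel (sphere 0 1))"
    using assms by (simp add: sets_restrict_space_iff)
  have eq: "sgn -` A \<inter> (ball 0 1 - {0}) = {r *\<^sub>R u | r u. 0 < r \<and> r < 1 \<and> u \<in> A}"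
  proof (intro equalityI subsetI)
    fix x assume "x \<in> sgn -` A \<inter> (ball 0 1 - {0})"
    then have "x = norm x *\<^sub>R sgn x" "0 < norm x" "norm x < 1" "sgn x \<in> A"
      by (auto simp: sgn_div_norm)
    then show "x \<in> {r *\<^sub>R u | r u. 0 < r \<and> r < 1 \<and> u \<in> A}" by blast
  next
    fix x assume "x \<in> {r *\<^sub>R u | r u. 0 < r \<and> r < 1 \<and> u \<in> A}"
    then obtain r u where "x = r *\<^sub>R u" "0 < r" "r < 1" "u \<in> A" by blast
    moreover from this assms(2) have "norm u = 1" by auto
    ultimately show "x \<in> sgn -` A \<inter> (ball 0 1 - {0})"
      by (auto simp: sgn_div_norm)
  qed
  show ?thesis
    unfolding sphere_measure_def using A
    by (simp add: emeasure_distr[OF sgn_measurable_sphere A] space_restrict_space eq[symmetric]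
        Int_commute emeasure_restrict_space)
qed

end

theory Submission
  imports Defs
begin

text \<open>With \<open>m = n - i\<close>, \<open>q = - m / p < 0\<close>, \<open>f = b(K,\<cdot>)\<^bsup>-p\<^esup>\<close> and \<open>g = b(L,\<cdot>)\<^bsup>-p\<^esup>\<close>, the claim is the
  reverse Minkowski inequality for the negative exponent \<open>q\<close>, which follows by integrating the
  convexity inequality for \<open>z \<mapsto> z\<^bsup>q\<^esup>\<close> with weights proportional to the integrals
  \<open>(\<integral>f\<^bsup>q\<^esup>)\<^bsup>1/q\<^esup>\<close> and \<open>(\<integral>g\<^bsup>q\<^esup>)\<^bsup>1/q\<^esup>\<close>.
  Equality forces \<open>f\<close> and \<open>g\<close> to be proportional almost everywhere, hence everywhere, because they
  are continuous and nonempty relatively open subsets of the sphere have positive measure.\<close>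

section \<open>Convexity of powers with negative exponent\<close>

text \<open>With z^q = exp(q ln z), the bound chains exp t \<ge> 1 + t and ln z \<le> z - 1, the
  latter reversed by the negative factor q. Equality in the chain forces ln z = z - 1, which holds
  only at z = 1; this yields the equality case of everything below.\<close>

lemma powr_neg_tangent:
  fixes z q :: real
  assumes "z > 0" "q < 0"
  shows "1 + q * (z - 1) \<le> z powr q"
    and "z powr q = 1 + q * (z - 1) \<Longrightarrow> z = 1"
proof -
  have exp: "1 + q * ln z \<le> z powr q"
    using assms exp_ge_add_one_self[of "q * ln z"] by (simp add: powr_def)
  have ln: "q * (z - 1) \<le> q * ln z"
    using assms ln_le_minus_one[of z] by (simp add: mult_left_mono_neg)
  from exp ln show "1 + q * (z - 1) \<le> z powr q" by linarith
  assume "z powr q = 1 + q * (z - 1)"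
  with exp ln have "q * (z - 1) = q * ln z" by linarith
  then have "ln z = z - 1" using assms by simp
  then show "z = 1" using ln_eq_minus_one[OF assms(1)] by simp
qed

text \<open>This is convexity of z^q in homogeneous form, with weights a and b at the points x/a and
  y/b. It follows from the tangent line at their weighted mean r, after rescaling by r so that the
  tangent point becomes 1. Equality holds exactly when both points coincide with r.\<close>

lemma powr_neg_perspective:
  fixes a b x y q :: real
  assumes "a > 0" "b > 0" "x > 0" "y > 0" "q < 0"
  shows "(a + b) * ((x + y) / (a + b)) powr q \<le> a * (x / a) powr q + b * (y / b) powr q"
    and "(a + b) * ((x + y) / (a + b)) powr q = a * (x / a) powr q + b * (y / b) powr q
           \<longleftrightarrow> b * x = a * y"
proof -
  define r where "r = (x + y) / (a + b)"
  define u where "u = x / a / r"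
  define v where "v = y / b / r"
  have pos: "r > 0" "u > 0" "v > 0"
    using assms by (simp_all add: r_def u_def v_def)
  have xa: "(x / a) powr q = r powr q * u powr q" and yb: "(y / b) powr q = r powr q * v powr q"
    using pos assms by (simp_all add: u_def v_def powr_mult[symmetric])
  \<comment> \<open>The ratios \<open>u\<close> and \<open>v\<close> have weighted mean 1, so the
    linear terms of the two tangent bounds cancel when added.\<close>
  have "a * u + b * v = (x + y) / r"
    using assms by (simp add: u_def v_def add_divide_distrib)
  also have "\<dots> = a + b"
    using assms by (simp add: r_def)
  finally have uv: "a * u + b * v = a + b" .
  have "a * (1 + q * (u - 1)) + b * (1 + q * (v - 1)) = a + b + q * ((a * u + b * v) - (a + b))"
    by (simp add: algebra_simps)
  then have lin: "a * (1 + q * (u - 1)) + b * (1 + q * (v - 1)) = a + b"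
    using uv by simp
  have au: "a * (1 + q * (u - 1)) \<le> a * u powr q" and bv: "b * (1 + q * (v - 1)) \<le> b * v powr q"
    using powr_neg_tangent(1) pos assms by simp_all
  have rhs: "a * (x / a) powr q + b * (y / b) powr q = r powr q * (a * u powr q + b * v powr q)"
    by (simp add: xa yb algebra_simps)
  have "a + b \<le> a * u powr q + b * v powr q"
    using au bv lin by linarith
  then show "(a + b) * ((x + y) / (a + b)) powr q \<le> a * (x / a) powr q + b * (y / b) powr q"
    unfolding rhs r_def[symmetric] mult.commute[of "a + b"] by (rule mult_left_mono) simp
  show "(a + b) * ((x + y) / (a + b)) powr q = a * (x / a) powr q + b * (y / b) powr q
           \<longleftrightarrow> b * x = a * y" (is "?eq \<longleftrightarrow> _")
  proof
    assume ?eq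
    then have "a + b = a * u powr q + b * v powr q"
      unfolding rhs r_def[symmetric] using pos by (simp add: mult.commute)
    \<comment> \<open>Equality in the sum of two inequalities forces equality in each.\<close>
    with au bv lin have "a * (1 + q * (u - 1)) = a * u powr q"
      and "b * (1 + q * (v - 1)) = b * v powr q" by (linarith, linarith)
    then have "u = 1" "v = 1"
      using powr_neg_tangent(2)[OF pos(2) assms(5)] powr_neg_tangent(2)[OF pos(3) assms(5)] assms
      by auto
    then have "x = a * r" "y = b * r"
      using assms pos by (simp_all add: u_def v_def field_simps)
    then show "b * x = a * y" by simp
  next
    assume "b * x = a * y"
    then have "x / a = r" "y / b = r"
      using assms by (simp_all add: r_def field_simps)
    then show ?eq unfolding r_def[symmetric] by (simp add: algebra_simps)
  qed
qed

section \<open>The reverse Minkowski inequality and its equality case\<close>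

lemma integral_powr_pos:
  fixes f :: "'a \<Rightarrow> real"
  assumes "integrable M (\<lambda>x. f x powr q)" "\<And>x. x \<in> space M \<Longrightarrow> f x > 0"
    and "emeasure M (space M) \<noteq> 0"
  shows "(\<integral>x. f x powr q \<partial>M) > 0"
proof (rule ccontr)
  assume "\<not> ?thesis"
  then have "(\<integral>x. f x powr q \<partial>M) = 0"
    by (simp add: antisym not_less)
  then have "AE x in M. f x powr q = 0"
    using integral_nonneg_eq_0_iff_AE[OF assms(1)] by simp
  then have "AE x in M. False"
    by (rule AE_mp) (intro AE_I2, use assms(2) in force)
  then show False
    using assms(3) by (simp add: AE_iff_null null_sets_def)
qed

lemma reverse_Minkowski:
  fixes f g :: "'a \<Rightarrow> real" and q :: real
  assumes q: "q < 0"
    and meas [measurable]: "f \<in> borel_measurable M" "g \<in> borel_measurable M"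
    and pos: "\<And>x. x \<in> space M \<Longrightarrow> f x > 0" "\<And>x. x \<in> space M \<Longrightarrow> g x > 0"
    and int: "integrable M (\<lambda>x. f x powr q)" "integrable M (\<lambda>x. g x powr q)"
    and nz: "emeasure M (space M) \<noteq> 0"
  shows "(\<integral>x. f x powr q \<partial>M) powr (1 / q) + (\<integral>x. g x powr q \<partial>M) powr (1 / q)
           \<le> (\<integral>x. (f x + g x) powr q \<partial>M) powr (1 / q)" (is "?X + ?Y \<le> ?Z")
    and "(\<integral>x. (f x + g x) powr q \<partial>M) powr (1 / q)
           = (\<integral>x. f x powr q \<partial>M) powr (1 / q) + (\<integral>x. g x powr q \<partial>M) powr (1 / q)
         \<longleftrightarrow> (\<exists>c>0. AE x in M. f x = c * g x)"
proof -
  define X where "X = ?X"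
  define Y where "Y = ?Y"
  define Z where "Z = ?Z"
  \<comment> \<open>Since q < 0 and f + g \<ge> f > 0, the integrand is dominated by f^q.\<close>
  have int_sum: "integrable M (\<lambda>x. (f x + g x) powr q)"
  proof (rule Bochner_Integration.integrable_bound[OF int(1)])
    show "AE x in M. norm ((f x + g x) powr q) \<le> norm (f x powr q)"
      using pos q by (intro AE_I2) (auto intro!: powr_mono2' simp: less_imp_le)
  qed measurable
  have ipos: "(\<integral>x. f x powr q \<partial>M) > 0" "(\<integral>x. g x powr q \<partial>M) > 0"
    "(\<integral>x. (f x + g x) powr q \<partial>M) > 0"
    using pos nz int int_sum by (auto intro!: integral_powr_pos add_pos_pos)
  have XYZ: "X > 0" "Y > 0" "Z > 0"
    using ipos by (simp_all add: X_def Y_def Z_def)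
  have Xq: "(\<integral>x. f x powr q \<partial>M) = X powr q" and Yq: "(\<integral>x. g x powr q \<partial>M) = Y powr q"
    and Zq: "(\<integral>x. (f x + g x) powr q \<partial>M) = Z powr q"
    using ipos q by (simp_all add: X_def Y_def Z_def powr_powr)
  have scale: "(h / c) powr q = h powr q / c powr q" if "c > 0" "h > 0" for h c :: real
    using that by (simp add: powr_divide)
  \<comment> \<open>The pointwise inequality is used with weights a = X and b = Y. They normalise
    f^q and g^q to integral 1, so \<open>?r\<close> integrates to X + Y and \<open>?l\<close> to (X
    + Y) (Z / (X + Y))^q.\<close>
  let ?l = "\<lambda>x. (X + Y) * ((f x + g x) powr q / (X + Y) powr q)"
  let ?r = "\<lambda>x. X * (f x powr q / X powr q) + Y * (g x powr q / Y powr q)"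
  have le: "?l x \<le> ?r x" and eq: "?l x = ?r x \<longleftrightarrow> Y * f x = X * g x" if "x \<in> space M" for x
    using powr_neg_perspective[OF XYZ(1,2) pos[OF that] q] XYZ pos[OF that]
    by (simp_all add: scale add_pos_pos)
  have int_l: "integrable M ?l" and int_r: "integrable M ?r"
    using int int_sum by auto
  have il: "integral\<^sup>L M ?l = (X + Y) * (Z powr q / (X + Y) powr q)"
    using int_sum by (simp add: Zq)
  have ir: "integral\<^sup>L M ?r = X + Y"
    using int XYZ by (simp add: Xq Yq)
  have cancel: "S * (a / b) \<le> S \<longleftrightarrow> a \<le> b" "S * (a / b) = S \<longleftrightarrow> a = b"
    if "S > 0" "b > 0" for S a b :: real
    using that by (simp_all add: field_simps)
  note cancel = cancel[OF add_pos_pos[OF XYZ(1,2)], of "(X + Y) powr q" "Z powr q"]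
  have "(X + Y) powr q > 0"
    using XYZ by simp
  note cancel = cancel[OF this]
  have "integral\<^sup>L M ?l \<le> integral\<^sup>L M ?r"
    using int_l int_r le by (intro integral_mono) auto
  then have Zle: "Z powr q \<le> (X + Y) powr q"
    unfolding il ir using cancel(1) by blast
  \<comment> \<open>The inequality between q-th powers turns around because q is negative.\<close>
  have "X + Y \<le> Z"
  proof (rule ccontr)
    assume "\<not> X + Y \<le> Z"
    then have "(X + Y) powr q < Z powr q"
      using XYZ q by (intro powr_less_mono2_neg) auto
    with Zle show False by simp
  qed
  then show "?X + ?Y \<le> ?Z" by (simp add: X_def Y_def Z_def)
  have "Z = X + Y \<longleftrightarrow> Z powr q = (X + Y) powr q"
  proof
    assume "Z powr q = (X + Y) powr q"
    then have "(Z powr q) powr (1 / q) = ((X + Y) powr q) powr (1 / q)" by simp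
    then show "Z = X + Y" using XYZ q by (simp add: powr_powr)
  qed simp
  also have "\<dots> \<longleftrightarrow> integral\<^sup>L M ?l = integral\<^sup>L M ?r"
    unfolding il ir using cancel(2) by blast
  \<comment> \<open>The difference is nonnegative, so equal integrals mean pointwise equality almost
    everywhere.\<close>
  also have "\<dots> \<longleftrightarrow> (\<integral>x. ?r x - ?l x \<partial>M) = 0"
    using Bochner_Integration.integral_diff[OF int_r int_l] by auto
  also have "\<dots> \<longleftrightarrow> (AE x in M. ?r x - ?l x = 0)"
    using int_l int_r le by (intro integral_nonneg_eq_0_iff_AE AE_I2) auto
  also have "\<dots> \<longleftrightarrow> (AE x in M. Y * f x = X * g x)"
    by (intro AE_cong) (use eq in force)
  also have "\<dots> \<longleftrightarrow> (\<exists>c>0. AE x in M. f x = c * g x)"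
  proof
    assume "AE x in M. Y * f x = X * g x"
    then have "AE x in M. f x = X / Y * g x"
      by (rule AE_mp) (use XYZ in \<open>auto simp: field_simps\<close>)
    then show "\<exists>c>0. AE x in M. f x = c * g x"
      using XYZ by (intro exI[of _ "X / Y"]) auto
  next
    assume "\<exists>c>0. AE x in M. f x = c * g x"
    then obtain c where c: "c > 0" "AE x in M. f x = c * g x" by blast
    \<comment> \<open>An arbitrary proportionality constant must equal X / Y: integrating the q-th
      powers of f = c g determines it.\<close>
    have "X powr q = (\<integral>x. c powr q * g x powr q \<partial>M)"
      unfolding Xq[symmetric]
    proof (rule integral_cong_AE)
      show "AE x in M. f x powr q = c powr q * g x powr q"
        using c(2) by (rule AE_mp) (use c(1) pos in \<open>auto intro!: AE_I2 simp: powr_mult\<close>)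
    qed measurable
    also have "\<dots> = (c * Y) powr q"
      using int c XYZ by (simp add: Yq powr_mult)
    finally have "(X powr q) powr (1 / q) = ((c * Y) powr q) powr (1 / q)" by simp
    then have "X = c * Y" using XYZ c q by (simp add: powr_powr)
    then show "AE x in M. Y * f x = X * g x"
      using c(2) by (auto simp: algebra_simps)
  qed
  finally show "?Z = ?X + ?Y \<longleftrightarrow> (\<exists>c>0. AE x in M. f x = c * g x)"
    by (simp add: X_def Y_def Z_def)
qed

section \<open>Continuity of the half width\<close>

text \<open>A finite supremum of linear functions is convex, and a convex function on all of a
  Euclidean space is continuous.\<close>

lemma continuous_on_support_fun:
  fixes K :: "'a::euclidean_space set"
  assumes "compact K" "K \<noteq> {}"
  shows "continuous_on S (support_fun K)"
proof -
  have bdd: "bdd_above ((\<lambda>y. x \<bullet> y) ` K)" for x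
    using assms(1) by (intro compact_imp_bounded[THEN bounded_imp_bdd_above]
        compact_continuous_image continuous_intros)
  have le: "x \<bullet> y \<le> support_fun K x" if "y \<in> K" for x y
    unfolding support_fun_def by (rule cSUP_upper[OF that bdd])
  have "convex_on UNIV (support_fun K)"
  proof (rule convex_onI)
    fix t :: real and x y :: 'a
    assume t: "0 < t" "t < 1"
    show "support_fun K ((1 - t) *\<^sub>R x + t *\<^sub>R y) \<le> (1 - t) * support_fun K x + t * support_fun K y"
      unfolding support_fun_def[of K "(1 - t) *\<^sub>R x + t *\<^sub>R y"]
    proof (rule cSUP_least[OF assms(2)])
      fix z assume "z \<in> K"
      then show "((1 - t) *\<^sub>R x + t *\<^sub>R y) \<bullet> z \<le> (1 - t) * support_fun K x + t * support_fun K y"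
        using t le[of z x] le[of z y] by (auto simp: inner_add_left intro!: add_mono mult_left_mono)
    qed
  qed simp
  from convex_on_continuous[OF open_UNIV this] show ?thesis
    using continuous_on_subset by blast
qed

lemma continuous_on_half_width:
  assumes "convex_body K"
  shows "continuous_on S (half_width K)"
proof -
  have cont: "continuous_on T (support_fun K)" for T
    using assms interior_subset[of K] by (intro continuous_on_support_fun) (auto simp: convex_body_def)
  show ?thesis
    unfolding half_width_def
    by (intro continuous_intros continuous_on_compose2[OF cont[of UNIV]]) auto
qed

section \<open>Finiteness and positivity of the sphere measure\<close>

lemma sets_sphere_measure:
  "sets (sphere_measure :: 'a::euclidean_space measure) = sets (restrict_space borel (sphere 0 1))"
  by (simp add: sphere_measure_def)

lemma finite_measure_sphere_measure:
  "finite_measure (sphere_measure :: 'a::euclidean_space measure)"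
proof (rule finite_measureI)
  let ?C = "{r *\<^sub>R u | r u. 0 < r \<and> r < 1 \<and> u \<in> sphere (0::'a) 1}"
  have "emeasure lborel ?C \<le> emeasure lborel (ball (0::'a) 1)"
    by (rule emeasure_mono) auto
  also have "\<dots> < \<infinity>"
    by (rule emeasure_bounded_finite) simp
  finally show "emeasure sphere_measure (space (sphere_measure :: 'a measure)) \<noteq> \<infinity>"
    by (simp add: space_sphere_measure emeasure_sphere_measure ennreal_mult_eq_top_iff)
qed

text \<open>The truncated cone over a nonempty relatively open set is a nonempty open set in the
  ambient space, hence has positive volume. It is open because it is the preimage of an open set
  under \<open>sgn\<close>, which is continuous away from the origin.\<close>

lemma emeasure_sphere_measure_openin_pos:
  fixes A :: "'a::euclidean_space set"
  assumes "openin (top_of_set (sphere 0 1)) A" "A \<noteq> {}"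
  shows "emeasure sphere_measure A \<noteq> 0"
proof -
  have sub: "A \<subseteq> sphere 0 1"
    using openin_imp_subset[OF assms(1)] .
  obtain T where T: "open T" "A = sphere 0 1 \<inter> T"
    using assms(1) by (auto simp: openin_open)
  have A: "A \<in> sets borel"
    using T by auto
  let ?C = "{r *\<^sub>R u | r u. 0 < r \<and> r < 1 \<and> u \<in> A}"
  have eq: "?C = (ball 0 1 - {0}) \<inter> sgn -` T"
  proof (intro equalityI subsetI)
    fix x assume "x \<in> ?C"
    then show "x \<in> (ball 0 1 - {0}) \<inter> sgn -` T"
      using T by (auto simp: sgn_div_norm)
  next
    fix x assume x: "x \<in> (ball 0 1 - {0}) \<inter> sgn -` T"
    then have "x = norm x *\<^sub>R sgn x" "0 < norm x" "norm x < 1" "sgn x \<in> A"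
      using T by (auto simp: sgn_div_norm)
    then show "x \<in> ?C" by blast
  qed
  have "continuous_on (ball 0 1 - {0}) (sgn :: 'a \<Rightarrow> 'a)"
    unfolding sgn_div_norm[abs_def] by (intro continuous_intros) auto
  then have "open ?C"
    unfolding eq using T(1) by (intro continuous_open_preimage open_delete open_ball)
  moreover have "?C \<noteq> {}"
  proof -
    obtain u where "u \<in> A" using assms(2) by blast
    then have "(1 / 2 :: real) *\<^sub>R u \<in> ?C" by (auto intro!: exI[of _ "1 / 2 :: real"] exI[of _ u])
    then show ?thesis by blast
  qed
  ultimately have "\<not> negligible ?C" "?C \<in> sets lborel"
    by (auto dest: open_not_negligible)
  then have "emeasure lborel ?C \<noteq> 0"
    by (auto simp: negligible_iff_null_sets null_sets_def)
  then show ?thesis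
    by (simp add: emeasure_sphere_measure[OF A sub])
qed

text \<open>The set of disagreement is relatively open, so it can be null only if it is empty. This
  upgrades the almost everywhere equality case of reverse Minkowski to all directions, as
  \<open>similar_width\<close> demands.\<close>

lemma AE_sphere_measure_eq_continuous:
  fixes f g :: "'a::euclidean_space \<Rightarrow> real"
  assumes "continuous_on (sphere 0 1) f" "continuous_on (sphere 0 1) g"
  shows "(AE u in sphere_measure. f u = g u) \<longleftrightarrow> (\<forall>u\<in>sphere 0 1. f u = g u)"
proof
  let ?A = "{u \<in> sphere 0 1. f u \<noteq> g u}"
  have "continuous_on (sphere 0 1) (\<lambda>u. f u - g u)"
    using assms by (intro continuous_intros)
  then have "openin (top_of_set (sphere 0 1)) (sphere 0 1 \<inter> (\<lambda>u. f u - g u) -` (- {0}))"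
    by (rule continuous_openin_preimage_gen) auto
  also have "sphere 0 1 \<inter> (\<lambda>u. f u - g u) -` (- {0}) = ?A"
    by auto
  finally have op: "openin (top_of_set (sphere 0 1)) ?A" .
  then obtain T where "open T" "?A = sphere 0 1 \<inter> T"
    unfolding openin_open by blast
  then have "?A \<in> sets sphere_measure"
    by (simp add: sets_sphere_measure sets_restrict_space)
  moreover assume "AE u in sphere_measure. f u = g u"
  ultimately have "emeasure sphere_measure ?A = 0"
    by (subst (asm) AE_iff_measurable[of ?A]) (auto simp: space_sphere_measure)
  with emeasure_sphere_measure_openin_pos[OF op] have "?A = {}" by blast
  then show "\<forall>u\<in>sphere 0 1. f u = g u" by blast
next
  assume "\<forall>u\<in>sphere 0 1. f u = g u"
  then show "AE u in sphere_measure. f u = g u"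
    by (intro AE_I2) (simp add: space_sphere_measure)
qed

lemma borel_measurable_sphere_measure_continuous:
  fixes f :: "'a::euclidean_space \<Rightarrow> real"
  assumes "continuous_on (sphere 0 1) f"
  shows "f \<in> borel_measurable sphere_measure"
  using borel_measurable_continuous_on_restrict[OF assms]
  by (simp cong: measurable_cong_sets add: sets_sphere_measure)

lemma integrable_sphere_measure_continuous:
  fixes f :: "'a::euclidean_space \<Rightarrow> real"
  assumes "continuous_on (sphere 0 1) f"
  shows "integrable sphere_measure f"
proof -
  interpret finite_measure "sphere_measure :: 'a measure"
    by (rule finite_measure_sphere_measure)
  have "bounded (f ` sphere 0 1)"
    using assms by (intro compact_imp_bounded compact_continuous_image) auto
  then obtain B where "\<forall>u\<in>sphere 0 1. norm (f u) \<le> B"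
    by (auto simp: bounded_iff)
  then show ?thesis
    using borel_measurable_sphere_measure_continuous[OF assms]
    by (intro integrable_const_bound[of _ B]) (auto simp: space_sphere_measure)
qed

section \<open>Application to width integrals\<close>

theorem corollary6p3:
  fixes K L :: "(real ^ 'n) set" and i :: nat and p :: real
  assumes "convex_body K" and "convex_body L"
    and "i < CARD('n)" and "p \<ge> 1"
  shows "width_integral_of i (half_width_Lp_sum p K L) powr (- p / real (CARD('n) - i))
           \<ge> width_integral i K powr (- p / real (CARD('n) - i))
             + width_integral i L powr (- p / real (CARD('n) - i))
       \<and> (width_integral_of i (half_width_Lp_sum p K L) powr (- p / real (CARD('n) - i))
           = width_integral i K powr (- p / real (CARD('n) - i))
             + width_integral i L powr (- p / real (CARD('n) - i))
         \<longleftrightarrow> similar_width K L)"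
proof -
  define m where "m = CARD('n) - i"
  define q where "q = - real m / p"
  define f where "f = (\<lambda>u. half_width K u powr (- p))"
  define g where "g = (\<lambda>u. half_width L u powr (- p))"
  \<comment> \<open>The factor 1/n of the width integral becomes this constant after raising to the
    power 1/q; it is common to all three terms and cancels at the end.\<close>
  define c where "c = (1 / real CARD('n)) powr (1 / q)"
  let ?S = "sphere_measure :: (real ^ 'n) measure"
  have m: "m > 0"
    using assms(3) by (simp add: m_def)
  then have q: "q < 0" and q1: "- p / real m = 1 / q"
    using assms(4) by (simp_all add: q_def)
  have c: "c > 0" by (simp add: c_def)
  have bpos: "half_width K u > 0" "half_width L u > 0" if "u \<in> sphere 0 1" for u
    using that assms half_width_pos by auto
  have powq: "b ^ m = (b powr (- p)) powr q" if "b > 0" for b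
    using that assms(4) by (simp add: q_def powr_powr powr_realpow)
  have cont: "continuous_on (sphere 0 1) f" "continuous_on (sphere 0 1) g"
    unfolding f_def g_def
    by (intro continuous_intros continuous_on_half_width assms; use bpos in force)+
  have fpos: "f u > 0" and gpos: "g u > 0" if "u \<in> sphere 0 1" for u
    using bpos[OF that] by (simp_all add: f_def g_def)
  have int: "integrable ?S (\<lambda>u. f u powr q)" "integrable ?S (\<lambda>u. g u powr q)"
    by (intro integrable_sphere_measure_continuous continuous_intros cont; use fpos gpos in force)+
  \<comment> \<open>Keeping \<open>h\<close> separate from \<open>w\<close> lets one statement cover
    K, L and the width sum; for the sum, \<open>h\<close> is f + g by the defining equation of
    \<open>half_width_Lp_sum\<close>.\<close>
  have wi: "width_integral_of i w powr (1 / q) = c * (\<integral>u. h u powr q \<partial>?S) powr (1 / q)"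
    if "\<And>u. u \<in> sphere 0 1 \<Longrightarrow> w u > 0 \<and> h u = w u powr (- p)" for w h :: "real ^ 'n \<Rightarrow> real"
  proof -
    have "(\<integral>u. w u ^ m \<partial>?S) = (\<integral>u. h u powr q \<partial>?S)"
      using that powq by (intro Bochner_Integration.integral_cong) (auto simp: space_sphere_measure)
    then show ?thesis
      by (simp add: width_integral_of_def m_def[symmetric] c_def powr_mult[symmetric])
  qed
  have WK: "width_integral i K powr (1 / q) = c * (\<integral>u. f u powr q \<partial>?S) powr (1 / q)"
    and WL: "width_integral i L powr (1 / q) = c * (\<integral>u. g u powr q \<partial>?S) powr (1 / q)"
    unfolding width_integral_def using bpos by (intro wi; simp add: f_def g_def)+
  have WS: "width_integral_of i (half_width_Lp_sum p K L) powr (1 / q)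
      = c * (\<integral>u. (f u + g u) powr q \<partial>?S) powr (1 / q)"
    using half_width_Lp_sum[OF assms(1,2) _ assms(4)] by (intro wi) (simp add: f_def g_def)
  \<comment> \<open>Any coordinate vector shows that the sphere is nonempty; being relatively open
    in itself, it then has positive measure.\<close>
  have "axis undefined 1 \<in> sphere (0 :: real ^ 'n) 1"
    by (simp add: norm_axis_1)
  then have nz: "emeasure ?S (space ?S) \<noteq> 0"
    by (intro emeasure_sphere_measure_openin_pos) (auto simp: space_sphere_measure)
  note Mink = reverse_Minkowski[OF q borel_measurable_sphere_measure_continuous[OF cont(1)]
      borel_measurable_sphere_measure_continuous[OF cont(2)] _ _ int nz]
  have "(\<exists>d>0. AE u in ?S. f u = d * g u) \<longleftrightarrow> (\<exists>d>0. \<forall>u\<in>sphere 0 1. f u = d * g u)"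
    by (intro ex_cong1 conj_cong refl AE_sphere_measure_eq_continuous continuous_intros cont)
  also have "\<dots> \<longleftrightarrow> similar_width K L"
  proof
    assume "\<exists>d>0. \<forall>u\<in>sphere 0 1. f u = d * g u"
    then obtain d where d: "d > 0" "\<And>u. u \<in> sphere 0 1 \<Longrightarrow> f u = d * g u" by blast
    \<comment> \<open>Proportionality of the (-p)-th powers with factor d is proportionality of the
      half widths with factor d^(-1/p); conversely a factor l becomes l^(-p).\<close>
    have "half_width K u = d powr (- 1 / p) * half_width L u" if "u \<in> sphere 0 1" for u
    proof -
      have "f u powr (- 1 / p) = (d * g u) powr (- 1 / p)"
        using d(2)[OF that] by simp
      then show ?thesis
        using bpos[OF that] d(1) assms(4) by (simp add: f_def g_def powr_mult powr_powr)
    qed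
    then show "similar_width K L"
      unfolding similar_width_def using d(1) by (intro exI[of _ "d powr (- 1 / p)"]) auto
  next
    assume "similar_width K L"
    then obtain l where l: "l > 0" "\<And>u. u \<in> sphere 0 1 \<Longrightarrow> half_width K u = l * half_width L u"
      unfolding similar_width_def by blast
    then show "\<exists>d>0. \<forall>u\<in>sphere 0 1. f u = d * g u"
      using bpos by (intro exI[of _ "l powr (- p)"]) (auto simp: f_def g_def powr_mult)
  qed
  finally have sim: "(\<exists>d>0. AE u in ?S. f u = d * g u) \<longleftrightarrow> similar_width K L" .
  show ?thesis
    unfolding m_def[symmetric] q1 WK WL WS distrib_left[symmetric] sim[symmetric]
    using Mink fpos gpos c by (simp add: space_sphere_measure)
qed

end
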